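(* (a) The maximum number of tangent pairs among $n$ bi-infinite $x$-monotone curves in which every two curves have at most one common point and no three curves share a common point is $\Theta(n\log n)$. (b) If in addition every two of the $n$ curves have precisely one common point, then the maximum number of tangent pairs is exactly $n-1$.
   Context: A curve is bi-infinite $x$-monotone if it is the graph of a continuous function $\mathbb{R}\to\mathbb{R}$. Every two curves of a family are assumed to intersect in finitely many points. Two curves are tangent if they have precisely one common point and this point is not a crossing point. *)

theory Defs
  imports Complex_Main "HOL-Library.Landau_Symbols"
begin

definition plane_graph :: "(real \<Rightarrow> real) \<Rightarrow> (real \<times> real) set" where
  "plane_graph f = {(x, f x) | x. True}"

definition bi_infinite_x_monotone :: "(real \<times> real) set \<Rightarrow> bool" where
  "bi_infinite_x_monotone A \<longleftrightarrow> (\<exists>f. continuous_on UNIV f \<and> A = plane_graph f)"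

text \<open>Near a crossing point, each curve passes from one strict side of the other curve to the
  opposite side. Since two curves of a family meet in finitely many points, every
  common point is isolated, and exactly one curve is strictly above the other on each side of it.\<close>

definition crossing_point ::
  "(real \<times> real) set \<Rightarrow> (real \<times> real) set \<Rightarrow> real \<times> real \<Rightarrow> bool" where
  "crossing_point A B p \<longleftrightarrow> p \<in> A \<inter> B \<and>
     (\<exists>f g. continuous_on UNIV f \<and> continuous_on UNIV g \<and> A = plane_graph f \<and> B = plane_graph g \<and>
       ((\<forall>\<^sub>F x in at_left (fst p). f x < g x) \<and> (\<forall>\<^sub>F x in at_right (fst p). g x < f x) \<or>
        (\<forall>\<^sub>F x in at_left (fst p). g x < f x) \<and> (\<forall>\<^sub>F x in at_right (fst p). f x < g x)))"

definition tangent :: "(real \<times> real) set \<Rightarrow> (real \<times> real) set \<Rightarrow> bool" where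
  "tangent A B \<longleftrightarrow> (\<exists>p. A \<inter> B = {p} \<and> \<not> crossing_point A B p)"

definition tangent_pairs :: "(real \<times> real) set set \<Rightarrow> (real \<times> real) set set set" where
  "tangent_pairs F = {{A, B} | A B. A \<in> F \<and> B \<in> F \<and> A \<noteq> B \<and> tangent A B}"

text \<open>The two intersection conditions below imply that any two curves meet in finitely many
  points, so this is not a separate condition.\<close>

definition at_most_one_common_family :: "(real \<times> real) set set \<Rightarrow> bool" where
  "at_most_one_common_family F \<longleftrightarrow>
     (\<forall>A\<in>F. bi_infinite_x_monotone A) \<and>
     (\<forall>A\<in>F. \<forall>B\<in>F. A \<noteq> B \<longrightarrow> (\<forall>p\<in>A \<inter> B. \<forall>q\<in>A \<inter> B. p = q)) \<and>
     (\<forall>A\<in>F. \<forall>B\<in>F. \<forall>C\<in>F. A \<noteq> B \<longrightarrow> A \<noteq> C \<longrightarrow> B \<noteq> C \<longrightarrow> A \<inter> B \<inter> C = {})"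

definition exactly_one_common_family :: "(real \<times> real) set set \<Rightarrow> bool" where
  "exactly_one_common_family F \<longleftrightarrow>
     at_most_one_common_family F \<and>
     (\<forall>A\<in>F. \<forall>B\<in>F. A \<noteq> B \<longrightarrow> (\<exists>!p. p \<in> A \<inter> B))"

definition tangency_counts :: "((real \<times> real) set set \<Rightarrow> bool) \<Rightarrow> nat \<Rightarrow> nat set" where
  "tangency_counts P n = {card (tangent_pairs F) | F. finite F \<and> card F = n \<and> P F}"

definition max_tangencies :: "((real \<times> real) set set \<Rightarrow> bool) \<Rightarrow> nat \<Rightarrow> nat" where
  "max_tangencies P n = Max (tangency_counts P n)"

text \<open>The set of counts is finite and nonempty in both settings, so its \<^const>\<open>Max\<close> is a
  maximum that is attained. The witnesses are tangent lines of the parabola \<open>y = x\<^sup>2\<close>.\<close>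

lemma finite_tangency_counts: "finite (tangency_counts P n)"
proof -
  have "card (tangent_pairs F) \<le> 2 ^ n" if "finite F" "card F = n" for F
  proof -
    have "card (tangent_pairs F) \<le> card (Pow F)"
      by (rule card_mono) (use that in \<open>auto simp: tangent_pairs_def\<close>)
    then show ?thesis using that by (simp add: card_Pow)
  qed
  then have "tangency_counts P n \<subseteq> {..2 ^ n}"
    by (auto simp: tangency_counts_def)
  then show ?thesis by (rule finite_subset) simp
qed

lemma exactly_one_common_family_exists:
  "\<exists>F. finite F \<and> card F = n \<and> exactly_one_common_family F"
proof -
  define l where "l = (\<lambda>(i::nat) x. 2 * real i * x - (real i)\<^sup>2)"
  define L where "L i = plane_graph (l i)" for i
  have mem: "(x, y) \<in> L i \<longleftrightarrow> y = 2 * real i * x - (real i)\<^sup>2" for x y i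
    by (auto simp: L_def l_def plane_graph_def)
  have meet: "p \<in> L i \<inter> L j \<longleftrightarrow> p = ((real i + real j) / 2, real i * real j)"
    if "i \<noteq> j" for i j p
  proof (cases p)
    case (Pair x y)
    have "x = (real i + real j) / 2"
      if "2 * real i * x - (real i)\<^sup>2 = 2 * real j * x - (real j)\<^sup>2"
    proof -
      have "(real i - real j) * (2 * x - (real i + real j)) = 0"
        using that by (simp add: algebra_simps power2_eq_square)
      then show ?thesis using \<open>i \<noteq> j\<close> by auto
    qed
    moreover have "2 * real i * x - (real i)\<^sup>2 = real i * real j"
      "2 * real j * x - (real j)\<^sup>2 = real i * real j" if "x = (real i + real j) / 2"
      unfolding that by (simp_all add: power2_eq_square field_simps)
    ultimately show ?thesis
      unfolding Pair Int_iff mem prod.inject by metis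
  qed
  have "inj L"
  proof (rule injI, rule ccontr)
    fix i j assume *: "L i = L j" "i \<noteq> j"
    have "(0, 2 * real i * 0 - (real i)\<^sup>2) \<in> L i" "(1, 2 * real i * 1 - (real i)\<^sup>2) \<in> L i"
      by (simp_all only: mem)
    then have "(0, 2 * real i * 0 - (real i)\<^sup>2) \<in> L i \<inter> L j"
      "(1, 2 * real i * 1 - (real i)\<^sup>2) \<in> L i \<inter> L j"
      using *(1) by blast+
    then show False unfolding meet[OF *(2)] by simp
  qed
  have bi: "bi_infinite_x_monotone (L i)" for i
    unfolding bi_infinite_x_monotone_def L_def
    by (rule exI[of _ "l i"]) (auto simp: l_def intro!: continuous_intros)
  have triple: "L i \<inter> L j \<inter> L k = {}" if "i \<noteq> j" "i \<noteq> k" "j \<noteq> k" for i j k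
  proof -
    have False if "p \<in> L i \<inter> L j" "p \<in> L i \<inter> L k" for p
      using that \<open>j \<noteq> k\<close> unfolding meet[OF \<open>i \<noteq> j\<close>] meet[OF \<open>i \<noteq> k\<close>] by auto
    then show ?thesis by blast
  qed
  have "exactly_one_common_family (L ` {..<n})"
    unfolding exactly_one_common_family_def at_most_one_common_family_def
  proof (intro conjI ballI impI)
    fix A B p q
    assume "A \<in> L ` {..<n}" "B \<in> L ` {..<n}" "A \<noteq> B" "p \<in> A \<inter> B" "q \<in> A \<inter> B"
    then obtain i j where "p \<in> L i \<inter> L j" "q \<in> L i \<inter> L j" "i \<noteq> j" by blast
    then show "p = q" using meet[OF \<open>i \<noteq> j\<close>] by simp
  next
    fix A B C
    assume "A \<in> L ` {..<n}" "B \<in> L ` {..<n}" "C \<in> L ` {..<n}" "A \<noteq> B" "A \<noteq> C" "B \<noteq> C"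
    then obtain i j k where *: "A = L i" "B = L j" "C = L k" and "i \<noteq> j" "i \<noteq> k" "j \<noteq> k" by blast
    then show "A \<inter> B \<inter> C = {}" unfolding * by (intro triple)
  next
    fix A B
    assume "A \<in> L ` {..<n}" "B \<in> L ` {..<n}" "A \<noteq> B"
    then obtain i j where *: "A = L i" "B = L j" and "i \<noteq> j" by blast
    show "\<exists>!p. p \<in> A \<inter> B" unfolding * meet[OF \<open>i \<noteq> j\<close>] by simp
  qed (use bi in auto)
  moreover have "card (L ` {..<n}) = n"
    using \<open>inj L\<close> by (simp add: card_image inj_on_subset)
  ultimately show ?thesis by blast
qed

lemma tangency_counts_nonempty:
  "tangency_counts at_most_one_common_family n \<noteq> {}"
  "tangency_counts exactly_one_common_family n \<noteq> {}"
  using exactly_one_common_family_exists[of n]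
  unfolding tangency_counts_def exactly_one_common_family_def by blast+

end

theory Submission
  imports Defs "HOL-Library.Discrete_Functions"
begin

text \<open>Number the curves by their height at an abscissa to the left of all common points, and let
  \<open>(a, b)\<close> be an edge if \<open>a\<close> touches \<open>b\<close> from below, so that \<open>a < b\<close>. Counting sign changes of
  differences shows that edges \<open>(a', b)\<close>, \<open>(a', b')\<close>, \<open>(a, b')\<close> with \<open>a' < a < b < b'\<close> are
  impossible. Hence each edge \<open>(a, b)\<close> is at least twice as long as all shorter edges at \<open>a\<close>, or as
  all shorter edges at \<open>b\<close>, which leaves \<open>O(n log n)\<close> edges. If all pairs meet, the edges are the
  pairs whose order is the same at both ends; no curve is then both a lower and an upper end, and the
  lower neighbours of a curve are consecutive among the lower ends of edges, so the graph is a
  forest.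

  For the lower bound in (a), interleave two copies of a configuration, let each curve of the first
  copy be touched by its twin in the second one, and then lift the second copy above the first, each
  pair crossing at most once, before running both copies. This doubles the number of tangencies and
  adds one for each twin pair. For (b), take a parabola and some of its tangent lines.\<close>

section \<open>Tangent graphs of functions\<close>

text \<open>An oriented form of tangency, with \<open>f\<close> as the lower curve. A tangent pair
  then corresponds to exactly one ordered pair, so touchings form a directed graph.\<close>

definition touches :: "(real \<Rightarrow> real) \<Rightarrow> (real \<Rightarrow> real) \<Rightarrow> bool" where
  "touches f g \<longleftrightarrow> (\<exists>p. f p = g p \<and> (\<forall>x. x \<noteq> p \<longrightarrow> f x < g x))"

lemma touches_le: "touches f g \<Longrightarrow> f x \<le> g x"
  unfolding touches_def by (metis order.order_iff_strict)

lemma touches_antisym: "touches f g \<Longrightarrow> \<not> touches g f"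
proof
  assume "touches f g" "touches g f"
  then obtain p where p: "\<And>x. x \<noteq> p \<Longrightarrow> f x < g x" unfolding touches_def by blast
  show False using p[of "p + 1"] touches_le[OF \<open>touches g f\<close>, of "p + 1"] by simp
qed

lemma plane_graph_Int: "p \<in> plane_graph f \<inter> plane_graph g \<longleftrightarrow> snd p = f (fst p) \<and> snd p = g (fst p)"
  unfolding plane_graph_def by (cases p) auto

lemma mem_plane_graph: "p \<in> plane_graph f \<longleftrightarrow> snd p = f (fst p)"
  unfolding plane_graph_def by (cases p) auto

lemma plane_graph_eq_iff: "plane_graph f = plane_graph g \<longleftrightarrow> f = g"
proof
  assume *: "plane_graph f = plane_graph g"
  show "f = g"
  proof
    fix x show "f x = g x"
      using mem_plane_graph[of "(x, f x)" f] mem_plane_graph[of "(x, f x)" g] * by simp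
  qed
qed simp

section \<open>Sign changes of differences and the tangency criterion\<close>

lemma meet_between:
  fixes f g :: "real \<Rightarrow> real"
  assumes "continuous_on UNIV f" "continuous_on UNIV g" "x < y"
    and "f x < g x \<and> g y < f y \<or> g x < f x \<and> f y < g y"
  obtains z where "x < z" "z < y" "f z = g z"
proof -
  have *: "continuous_on {x..y} (\<lambda>t. f t - g t)" "continuous_on {x..y} (\<lambda>t. g t - f t)"
    using assms(1,2) by (auto intro!: continuous_intros intro: continuous_on_subset)
  have "\<exists>z. x \<le> z \<and> z \<le> y \<and> f z - g z = 0" if "f x < g x" "g y < f y"
    by (rule IVT') (use that * assms(3) in simp_all)
  moreover have "\<exists>z. x \<le> z \<and> z \<le> y \<and> g z - f z = 0" if "g x < f x" "f y < g y"
    by (rule IVT') (use that * assms(3) in simp_all)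
  ultimately obtain z where z: "x \<le> z" "z \<le> y" "f z = g z"
    using assms(4) by (metis eq_iff_diff_eq_0)
  with assms(4) have "x \<noteq> z" "y \<noteq> z" by auto
  with z that show thesis by force
qed

text \<open>Each sign change of \<open>f - g\<close> costs a common point, by the intermediate value
  theorem, and \<open>y\<close> separates the two points. Continuity enters the forbidden pattern
  argument through this fact.\<close>

lemma no_two_sign_changes:
  fixes f g :: "real \<Rightarrow> real"
  assumes "continuous_on UNIV f" "continuous_on UNIV g"
    and once: "\<And>x y. f x = g x \<Longrightarrow> f y = g y \<Longrightarrow> x = y"
    and "x < y" "y < z" "f x < g x" "g y < f y" "f z < g z"
  shows False
proof -
  obtain s where "x < s" "s < y" "f s = g s" by (rule meet_between[OF assms(1,2,4)]) (simp add: assms(6,7))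
  moreover obtain t where "y < t" "t < z" "f t = g t" by (rule meet_between[OF assms(1,2,5)]) (simp add: assms(7,8))
  ultimately show False using once[of s t] by simp
qed

text \<open>One sample on each side of the only common point decides the sign on that whole side,
  since a sign change there would need a second common point.\<close>

lemma touches_if_same_sign:
  fixes f g :: "real \<Rightarrow> real"
  assumes "continuous_on UNIV f" "continuous_on UNIV g"
    and t: "f t = g t" and once: "\<And>x. f x = g x \<Longrightarrow> x = t"
    and s: "s < t" "t < s'" "f s < g s" "f s' < g s'"
  shows "touches f g"
proof -
  have "f x < g x" if "x \<noteq> t" for x
  proof (rule ccontr)
    assume "\<not> f x < g x"
    then have gf: "g x < f x" using once[of x] that by (meson linorder_less_linear)
    \<comment> \<open>The sample on the same side of \<open>t\<close> as \<open>x\<close>, so that a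
      common point between \<open>r\<close> and \<open>x\<close> is different from
      \<open>t\<close>.\<close>
    define r where "r = (if x < t then s else s')"
    have r: "f r < g r" "x < t \<longleftrightarrow> r < t" using s by (auto simp: r_def)
    have "x \<noteq> r" using r(1) gf by auto
    then have "min x r < max x r" by simp
    moreover have "f (min x r) < g (min x r) \<and> g (max x r) < f (max x r) \<or>
        g (min x r) < f (min x r) \<and> f (max x r) < g (max x r)"
      using r(1) gf by (simp add: min_def max_def)
    ultimately obtain z where "min x r < z" "z < max x r" "f z = g z"
      by (rule meet_between[OF assms(1,2)])
    then show False using once[of z] \<open>x \<noteq> t\<close> s(1,2) by (auto simp: r_def split: if_splits)
  qed
  then show ?thesis unfolding touches_def using t by blast
qed

text \<open>The difference has constant sign on each side of the common point: opposite signs amount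
  to a crossing point, equal signs to a touching. This is the bridge from point sets to
  functions.\<close>

lemma tangent_plane_graph_iff:
  assumes cont: "continuous_on UNIV f" "continuous_on UNIV g"
    and once: "\<And>x y. f x = g x \<Longrightarrow> f y = g y \<Longrightarrow> x = y"
  shows "tangent (plane_graph f) (plane_graph g) \<longleftrightarrow> touches f g \<or> touches g f"
proof
  assume "tangent (plane_graph f) (plane_graph g)"
  then obtain p where p: "plane_graph f \<inter> plane_graph g = {p}"
    and nc: "\<not> crossing_point (plane_graph f) (plane_graph g) p"
    unfolding tangent_def by blast
  define t where "t = fst p"
  have ft: "f t = g t" using plane_graph_Int[of p f g] p by (auto simp: t_def)
  have tx: "x = t" if "f x = g x" for x using once[OF that ft] .
  have ft': "g t = f t" and tx': "\<And>x. g x = f x \<Longrightarrow> x = t" using ft tx by metis+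
  show "touches f g \<or> touches g f"
  proof (rule ccontr)
    assume no: "\<not> (touches f g \<or> touches g f)"
    have opposite: "f s < g s \<longleftrightarrow> g s' < f s'" if "s < t" "t < s'" for s s'
    proof -
      have "f s \<noteq> g s" "f s' \<noteq> g s'" using tx[of s] tx[of s'] that by auto
      then show ?thesis
        using no touches_if_same_sign[OF cont ft tx that] touches_if_same_sign[OF cont(2,1) ft' tx' that]
        by linarith
    qed
    have "crossing_point (plane_graph f) (plane_graph g) p"
      unfolding crossing_point_def
    proof (intro conjI exI)
      show "p \<in> plane_graph f \<inter> plane_graph g" using p by simp
      show "(\<forall>\<^sub>F x in at_left (fst p). f x < g x) \<and> (\<forall>\<^sub>F x in at_right (fst p). g x < f x) \<or>
        (\<forall>\<^sub>F x in at_left (fst p). g x < f x) \<and> (\<forall>\<^sub>F x in at_right (fst p). f x < g x)"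
      proof (cases "f (t - 1) < g (t - 1)")
        case True
        then have r: "g x < f x" if "t < x" for x using opposite[of "t - 1" x] that by simp
        then have "f x < g x" if "x < t" for x using opposite[of x "t + 1"] that by simp
        with r show ?thesis unfolding t_def[symmetric]
          by (intro disjI1 conjI) (auto simp: eventually_at_left_real eventually_at_right_real eventually_at_filter)
      next
        case False
        then have r: "f x < g x" if "t < x" for x
          using opposite[of "t - 1" x] that tx[of x] by force
        then have "\<not> g (t + 1) < f (t + 1)" by (simp add: less_imp_le not_less)
        then have "g x < f x" if "x < t" for x
          using opposite[of x "t + 1"] that tx[of x] by force
        with r show ?thesis unfolding t_def[symmetric]
          by (intro disjI2 conjI) (auto simp: eventually_at_filter)
      qed
    qed (use cont in auto)
    with nc show False by blast
  qed
next
  have *: "tangent (plane_graph f) (plane_graph g) \<and> tangent (plane_graph g) (plane_graph f)"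
    if "touches f g" for f g
  proof -
    obtain t where t: "f t = g t" "\<And>x. x \<noteq> t \<Longrightarrow> f x < g x" using \<open>touches f g\<close> unfolding touches_def by blast
    have eq: "plane_graph f \<inter> plane_graph g = {(t, f t)}"
    proof (intro set_eqI)
      fix p show "p \<in> plane_graph f \<inter> plane_graph g \<longleftrightarrow> p \<in> {(t, f t)}"
        using t(1) t(2)[of "fst p"] unfolding plane_graph_Int by (cases p; cases "fst p = t") auto
    qed
    \<comment> \<open>Either form of crossing would put the lower curve strictly above the other one
      on some side of \<open>t\<close>.\<close>
    have ne: "\<not> (\<forall>\<^sub>F x in at_left t. g x < f x)" "\<not> (\<forall>\<^sub>F x in at_right t. g x < f x)"
      using leD[OF touches_le[OF \<open>touches f g\<close>]] by simp_all
    have "\<not> crossing_point (plane_graph f) (plane_graph g) (t, f t)"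
      "\<not> crossing_point (plane_graph g) (plane_graph f) (t, f t)"
      using ne unfolding crossing_point_def plane_graph_eq_iff by auto
    with eq show ?thesis unfolding tangent_def by (metis Int_commute)
  qed
  assume "touches f g \<or> touches g f"
  then show "tangent (plane_graph f) (plane_graph g)" using * by blast
qed

section \<open>Indexed families of curves and their touching graph\<close>

definition touch_pairs :: "nat \<Rightarrow> (nat \<Rightarrow> real \<Rightarrow> real) \<Rightarrow> (nat \<times> nat) set" where
  "touch_pairs n F = {(i, j). i < n \<and> j < n \<and> touches (F i) (F j)}"

lemma finite_touch_pairs [simp]: "finite (touch_pairs n F)"
  by (rule finite_subset[of _ "{..<n} \<times> {..<n}"]) (auto simp: touch_pairs_def)

locale curve_system =
  fixes n :: nat and F :: "nat \<Rightarrow> real \<Rightarrow> real"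
  assumes cont: "i < n \<Longrightarrow> continuous_on UNIV (F i)"
    and once: "i < n \<Longrightarrow> j < n \<Longrightarrow> i \<noteq> j \<Longrightarrow> F i x = F j x \<Longrightarrow> F i y = F j y \<Longrightarrow> x = y"
    and no_triple: "i < n \<Longrightarrow> j < n \<Longrightarrow> k < n \<Longrightarrow> i \<noteq> j \<Longrightarrow> i \<noteq> k \<Longrightarrow> j \<noteq> k \<Longrightarrow>
      F i x = F j x \<Longrightarrow> F i x \<noteq> F k x"
begin

definition curves :: "(real \<times> real) set set" where
  "curves = (\<lambda>i. plane_graph (F i)) ` {..<n}"

lemma inj_plane_graph: "inj_on (\<lambda>i. plane_graph (F i)) {..<n}"
proof (rule inj_onI, rule ccontr)
  fix i j assume "i \<in> {..<n}" "j \<in> {..<n}" "plane_graph (F i) = plane_graph (F j)" "i \<noteq> j"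
  \<comment> \<open>Equal functions would agree both at 0 and at 1, which \<open>once\<close>
    forbids.\<close>
  then show False using once[of i j 0 1] unfolding plane_graph_eq_iff by simp
qed

lemma finite_curves: "finite curves"
  and card_curves: "card curves = n"
  using card_image[OF inj_plane_graph] by (simp_all add: curves_def)

lemma at_most_one_common_family_curves: "at_most_one_common_family curves"
  unfolding at_most_one_common_family_def
proof (intro conjI ballI impI)
  fix A assume "A \<in> curves"
  then show "bi_infinite_x_monotone A"
    using cont unfolding curves_def bi_infinite_x_monotone_def by blast
next
  fix A B p q assume "A \<in> curves" "B \<in> curves" "A \<noteq> B" and pq: "p \<in> A \<inter> B" "q \<in> A \<inter> B"
  then obtain i j where ij: "i < n" "j < n" "i \<noteq> j" "A = plane_graph (F i)" "B = plane_graph (F j)"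
    unfolding curves_def by auto
  have "fst p = fst q"
    by (rule once[OF ij(1-3)]) (use pq in \<open>auto simp: ij mem_plane_graph\<close>)
  then show "p = q" using pq unfolding ij plane_graph_Int by (simp add: prod_eq_iff)
next
  fix A B C assume "A \<in> curves" "B \<in> curves" "C \<in> curves" "A \<noteq> B" "A \<noteq> C" "B \<noteq> C"
  then obtain i j k where ijk: "i < n" "j < n" "k < n" "i \<noteq> j" "i \<noteq> k" "j \<noteq> k"
    "A = plane_graph (F i)" "B = plane_graph (F j)" "C = plane_graph (F k)"
    unfolding curves_def by auto
  show "A \<inter> B \<inter> C = {}"
  proof (intro equals0I)
    fix p assume "p \<in> A \<inter> B \<inter> C"
    then have "F i (fst p) = F j (fst p)" "F i (fst p) = F k (fst p)"
      unfolding ijk(7-9) Int_iff mem_plane_graph by simp_all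
    with no_triple[OF ijk(1-6)] show False by blast
  qed
qed

text \<open>Since \<open>touches\<close> is antisymmetric, each unordered tangent pair is counted by
  exactly one ordered index pair. The bounds below can therefore be proved for
  \<open>touch_pairs\<close>.\<close>

lemma card_tangent_pairs: "card (tangent_pairs curves) = card (touch_pairs n F)"
proof -
  define h where "h = (\<lambda>(i, j). {plane_graph (F i), plane_graph (F j)})"
  have tan: "tangent (plane_graph (F i)) (plane_graph (F j)) \<longleftrightarrow> touches (F i) (F j) \<or> touches (F j) (F i)"
    if "i < n" "j < n" "i \<noteq> j" for i j
    by (rule tangent_plane_graph_iff) (use cont once that in blast)+
  have irrefl: "i \<noteq> j" if "(i, j) \<in> touch_pairs n F" for i j
    using that touches_antisym unfolding touch_pairs_def by auto
  have "inj_on h (touch_pairs n F)"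
  proof (rule inj_onI)
    fix e e' assume e: "e \<in> touch_pairs n F" "e' \<in> touch_pairs n F" "h e = h e'"
    obtain i j i' j' where ij: "e = (i, j)" "e' = (i', j')" by fastforce
    from e have "i < n" "j < n" "i' < n" "j' < n" and t: "touches (F i) (F j)" "touches (F i') (F j')"
      unfolding ij touch_pairs_def by auto
    moreover have "{i, j} = {i', j'}"
      using e(3) inj_on_image_eq_iff[OF inj_plane_graph, of "{i, j}" "{i', j'}"] calculation
      unfolding ij h_def by simp
    ultimately show "e = e'" using touches_antisym[OF t(1)] unfolding ij doubleton_eq_iff by auto
  qed
  moreover have "h ` touch_pairs n F = tangent_pairs curves"
  proof (intro equalityI subsetI)
    fix P assume "P \<in> h ` touch_pairs n F"
    then obtain i j where ij: "(i, j) \<in> touch_pairs n F" "P = {plane_graph (F i), plane_graph (F j)}"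
      unfolding h_def by auto
    from ij(1) irrefl have "i < n" "j < n" "i \<noteq> j" "touches (F i) (F j)" unfolding touch_pairs_def by auto
    then have "tangent (plane_graph (F i)) (plane_graph (F j))" "plane_graph (F i) \<noteq> plane_graph (F j)"
      "plane_graph (F i) \<in> curves" "plane_graph (F j) \<in> curves"
      using tan inj_on_eq_iff[OF inj_plane_graph, of i j] by (auto simp: curves_def)
    then show "P \<in> tangent_pairs curves" unfolding tangent_pairs_def ij(2) by blast
  next
    fix P assume "P \<in> tangent_pairs curves"
    then obtain i j where ij: "i < n" "j < n" "plane_graph (F i) \<noteq> plane_graph (F j)"
      "tangent (plane_graph (F i)) (plane_graph (F j))" "P = {plane_graph (F i), plane_graph (F j)}"
      unfolding tangent_pairs_def curves_def by blast
    then have "touches (F i) (F j) \<or> touches (F j) (F i)" using tan[of i j] by blast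
    then have "(i, j) \<in> touch_pairs n F \<or> (j, i) \<in> touch_pairs n F"
      using ij unfolding touch_pairs_def by simp
    then show "P \<in> h ` touch_pairs n F"
      unfolding h_def ij(5) by (force simp: insert_commute)
  qed
  ultimately show ?thesis using card_image by metis
qed

lemma card_touch_pairs_le_max: "card (touch_pairs n F) \<le> max_tangencies at_most_one_common_family n"
  unfolding max_tangencies_def
proof (rule Max_ge[OF finite_tangency_counts])
  show "card (touch_pairs n F) \<in> tangency_counts at_most_one_common_family n"
    unfolding tangency_counts_def mem_Collect_eq
    by (rule exI[of _ curves])
      (simp add: card_tangent_pairs finite_curves card_curves at_most_one_common_family_curves)
qed

end

locale sorted_curve_system = curve_system +
  fixes T :: real
  assumes sorted: "i < j \<Longrightarrow> j < n \<Longrightarrow> F i T < F j T"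
    and before_meets: "i < n \<Longrightarrow> j < n \<Longrightarrow> i \<noteq> j \<Longrightarrow> F i x = F j x \<Longrightarrow> T < x"

text \<open>Finitely many pairs with at most one common point each have finitely many meeting
  abscissas. Left of all of them the heights are distinct, so sorting by height at \<open>T\<close>
  numbers the curves. The right end \<open>T'\<close> serves the case in which all pairs
  meet.\<close>

lemma sorted_curve_system_exists:
  assumes "finite S" "card S = n" "at_most_one_common_family S"
  obtains F T T' where "sorted_curve_system n F T" "S = (\<lambda>i. plane_graph (F i)) ` {..<n}"
    "\<And>i j x. i < n \<Longrightarrow> j < n \<Longrightarrow> i \<noteq> j \<Longrightarrow> F i x = F j x \<Longrightarrow> x < T'"
proof -
  note fam =
    assms(3)[unfolded at_most_one_common_family_def, THEN conjunct1, rule_format]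
    assms(3)[unfolded at_most_one_common_family_def, THEN conjunct2, THEN conjunct1, rule_format]
    assms(3)[unfolded at_most_one_common_family_def, THEN conjunct2, THEN conjunct2, rule_format]
  define fn where "fn A = (SOME f. continuous_on UNIV f \<and> A = plane_graph f)" for A
  have fn: "continuous_on UNIV (fn A)" "plane_graph (fn A) = A" if "A \<in> S" for A
  proof -
    from fam(1)[OF that] have "continuous_on UNIV (fn A) \<and> A = plane_graph (fn A)"
      unfolding fn_def bi_infinite_x_monotone_def by (rule someI_ex)
    then show "continuous_on UNIV (fn A)" "plane_graph (fn A) = A"
      by (rule conjunct1, rule conjunct2[THEN sym])
  qed
  have mem: "(x, fn A x) \<in> A" if "A \<in> S" for A x
    using fn(2)[OF that] mem_plane_graph[of "(x, fn A x)" "fn A"] by simp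
  have once: "x = y" if "A \<in> S" "B \<in> S" "A \<noteq> B" "fn A x = fn B x" "fn A y = fn B y" for A B x y
  proof -
    have "(x, fn A x) \<in> A \<inter> B" "(y, fn A y) \<in> A \<inter> B"
      using mem[OF that(1), of x] mem[OF that(2), of x] mem[OF that(1), of y] mem[OF that(2), of y]
        that(4,5) by simp_all
    from fam(2)[OF that(1-3) this] show ?thesis by simp
  qed
  define X where "X = (\<Union>A\<in>S. \<Union>B\<in>S - {A}. {x. fn A x = fn B x})"
  have "finite X"
    unfolding X_def
  proof (intro finite_UN_I \<open>finite S\<close> finite_Diff)
    fix A B assume "A \<in> S" "B \<in> S - {A}"
    then have "x = y" if "fn A x = fn B x" "fn A y = fn B y" for x y
      using once[of A B x y] that by blast
    then have "{x. fn A x = fn B x} = {} \<or> (\<exists>x. {x. fn A x = fn B x} = {x})" by blast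
    then show "finite {x. fn A x = fn B x}" by auto
  qed
  \<comment> \<open>Inserting 0 keeps \<open>Min\<close> and \<open>Max\<close> meaningful when no
    two curves meet.\<close>
  define T where "T = Min (insert 0 X) - 1"
  define T' where "T' = Max (insert 0 X) + 1"
  have T: "T < x" "x < T'" if "x \<in> X" for x
  proof -
    have "Min (insert 0 X) \<le> x" "x \<le> Max (insert 0 X)"
      using that \<open>finite X\<close> by (auto intro: Min_le Max_ge)
    then show "T < x" "x < T'" unfolding T_def T'_def by linarith+
  qed
  have TX: "T \<notin> X" using T(1)[of T] by auto
  define key where "key A = fn A T" for A
  have inj: "inj_on key S"
    unfolding inj_on_def key_def using TX unfolding X_def by blast
  define xs where "xs = sorted_list_of_set (key ` S)"
  have len: "length xs = n" using card_image[OF inj] assms(2) by (simp add: xs_def)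
  have setxs: "set xs = key ` S" using assms(1) by (simp add: xs_def)
  define c where "c i = inv_into S key (xs ! i)" for i
  have c: "c i \<in> S" "key (c i) = xs ! i" if "i < n" for i
    using that len setxs nth_mem[of i xs] by (auto simp: c_def inv_into_into f_inv_into_f)
  define F where "F i = fn (c i)" for i
  have lt: "F i T < F j T" if "i < j" "j < n" for i j
  proof -
    have "xs ! i < xs ! j"
      using sorted_wrt_nth_less[of "(<)" xs i j] strict_sorted_list_of_set[of "key ` S"] that len
      by (simp add: xs_def)
    then show ?thesis using c that unfolding F_def key_def by simp
  qed
  have ne: "c i \<noteq> c j" if "i < n" "j < n" "i \<noteq> j" for i j
    using lt[of i j] lt[of j i] that unfolding F_def by (metis less_irrefl linorder_neqE_nat)
  have meet: "x \<in> X" if "i < n" "j < n" "i \<noteq> j" "F i x = F j x" for i j x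
    unfolding X_def
    using c(1)[OF that(1)] c(1)[OF that(2)] ne[OF that(1-3)] that(4)[unfolded F_def] by blast
  have "S = c ` {..<n}"
  proof -
    have "inj_on c {..<n}" using ne by (auto simp: inj_on_def)
    then have "card (c ` {..<n}) = card S" using assms(2) by (simp add: card_image)
    then show ?thesis using card_subset_eq[OF assms(1), of "c ` {..<n}"] c(1) by blast
  qed
  also have "\<dots> = (\<lambda>i. plane_graph (F i)) ` {..<n}"
    by (intro image_cong refl) (simp add: F_def fn(2) c(1))
  finally have S: "S = (\<lambda>i. plane_graph (F i)) ` {..<n}" .
  have "sorted_curve_system n F T"
  proof
    fix i j k x assume ijk: "i < n" "j < n" "k < n" "i \<noteq> j" "i \<noteq> k" "j \<noteq> k" and eq: "F i x = F j x"
    have "c i \<inter> c j \<inter> c k = {}"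
      by (rule fam(3)) (use c(1) ne ijk in blast)+
    then show "F i x \<noteq> F k x"
      using mem[OF c(1)[OF ijk(1)], of x] mem[OF c(1)[OF ijk(2)], of x] mem[OF c(1)[OF ijk(3)], of x] eq
      unfolding F_def by auto
  next
    fix i j x y assume "i < n" "j < n" "i \<noteq> j" "F i x = F j x" "F i y = F j y"
    then show "x = y" using once[of "c i" "c j"] c(1) ne unfolding F_def by blast
  next
    fix i j x assume "i < n" "j < n" "i \<noteq> j" "F i x = F j x"
    then show "T < x" using T(1) meet by blast
  qed (simp_all add: F_def fn(1) c(1) lt[unfolded F_def])
  then show thesis
  proof (rule that)
    show "S = (\<lambda>i. plane_graph (F i)) ` {..<n}" by (fact S)
    show "x < T'" if "i < n" "j < n" "i \<noteq> j" "F i x = F j x" for i j x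
      using T(2)[OF meet[OF that]] .
  qed
qed

section \<open>Upper bounds\<close>

context sorted_curve_system
begin

lemma no_two_sign_changes':
  assumes "i < n" "j < n" "i \<noteq> j" "x < y" "y < z" "F i x < F j x" "F j y < F i y" "F i z < F j z"
  shows False
  using no_two_sign_changes[OF cont[OF assms(1)] cont[OF assms(2)] once[OF assms(1-3)] assms(4-8)] .

lemma touches_imp_less:
  assumes "i < n" "j < n" "touches (F i) (F j)"
  shows "i < j"
proof (rule ccontr)
  assume "\<not> i < j"
  moreover have "i \<noteq> j" using assms(3) touches_antisym by auto
  ultimately have "F j T < F i T" using sorted assms(1) by simp
  with touches_le[OF assms(3), of T] show False by simp
qed

lemma touch_point:
  assumes "(i, j) \<in> touch_pairs n F"
  obtains p where "i < j" "j < n" "T < p" "F i p = F j p" "\<And>x. x \<noteq> p \<Longrightarrow> F i x < F j x"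
proof -
  from assms have ij: "i < n" "j < n" "touches (F i) (F j)" unfolding touch_pairs_def by auto
  then obtain p where p: "F i p = F j p" "\<And>x. x \<noteq> p \<Longrightarrow> F i x < F j x" unfolding touches_def by blast
  have "i < j" using touches_imp_less[OF ij] .
  moreover have "T < p" using before_meets[OF ij(1,2) _ p(1)] \<open>i < j\<close> by simp
  ultimately show thesis using that ij(2) p by blast
qed

text \<open>Let \<open>(a', b)\<close>, \<open>(a', b')\<close>, \<open>(a, b')\<close> touch at
  \<open>u\<close>, \<open>v\<close>, \<open>y\<close>. At \<open>v\<close> the curve
  \<open>a\<close> is below the point shared by \<open>a'\<close> and \<open>b'\<close>, and
  \<open>b\<close> is above it. Both \<open>u\<close> and \<open>y\<close> turn out to precede
  \<open>v\<close>, and at the earlier of them \<open>b\<close> is below \<open>a\<close>. Thus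
  \<open>a\<close> and \<open>b\<close> would change order twice.\<close>

lemma no_crossed_touchings:
  assumes ord: "a' < a" "a < b" "b < b'"
    and e: "(a', b) \<in> touch_pairs n F" "(a', b') \<in> touch_pairs n F" "(a, b') \<in> touch_pairs n F"
  shows False
proof -
  obtain u where u: "T < u" "F a' u = F b u" "\<And>x. x \<noteq> u \<Longrightarrow> F a' x < F b x"
    using touch_point[OF e(1)] by metis
  obtain v where v: "T < v" "F a' v = F b' v" "\<And>x. x \<noteq> v \<Longrightarrow> F a' x < F b' x"
    using touch_point[OF e(2)] by metis
  obtain y where y: "T < y" "F a y = F b' y" "\<And>x. x \<noteq> y \<Longrightarrow> F a x < F b' x" and "b' < n"
    using touch_point[OF e(3)] by metis
  have idx: "a < n" "a' < n" "b < n" "b' < n" using ord \<open>b' < n\<close> by auto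
  have T: "F a' T < F a T" "F a T < F b T" "F b T < F b' T"
    using sorted ord idx by simp_all
  have "y \<noteq> v" using no_triple[OF idx(1,2,4), of y] y(2) v(2) ord by auto
  then have ay: "F a' y < F a y" and av: "F a v < F a' v" using v y by metis+
  \<comment> \<open>\<open>a'\<close> is below \<open>a\<close> at \<open>T\<close> and at
    \<open>y\<close> but above it at \<open>v\<close>, so \<open>v\<close> cannot lie between
    them.\<close>
  have "y < v"
  proof (rule ccontr)
    assume "\<not> y < v"
    then have "v < y" using \<open>y \<noteq> v\<close> by simp
    with no_two_sign_changes'[OF idx(2,1) _ v(1) _ T(1) av ay] ord show False by simp
  qed
  have "u \<noteq> v" using no_triple[OF idx(2,3,4), of v] u(2) v(2) ord by auto
  then have bu: "F b u < F b' u" and bv: "F b' v < F b v" using v(3)[of u] u(3)[of v] u(2) v(2) by simp_all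
  \<comment> \<open>The same argument for \<open>b\<close> and \<open>b'\<close>, with
    \<open>u\<close> in the role of \<open>y\<close>.\<close>
  have "u < v"
  proof (rule ccontr)
    assume "\<not> u < v"
    then have "v < u" using \<open>u \<noteq> v\<close> by simp
    with no_two_sign_changes'[OF idx(3,4) _ v(1) _ T(3) bv bu] ord show False by simp
  qed
  \<comment> \<open>The witness is the smaller of \<open>u\<close> and \<open>y\<close>. At
    \<open>u\<close> the wrong order would give \<open>a'\<close> and \<open>a\<close> two sign
    changes, the second one before \<open>y\<close>; at \<open>y\<close> it would give
    \<open>b\<close> and \<open>b'\<close> two, the second one before \<open>u\<close>.\<close>
  have "\<exists>z. T < z \<and> z < v \<and> F b z < F a z"
  proof (cases "u \<le> y")
    case True
    have "F a' u \<noteq> F a u" using no_triple[OF idx(2,1,3), of u] u(2) ord by auto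
    moreover have False if "F a u < F a' u"
    proof -
      have "u < y" using True ay that by (cases "u = y") auto
      with no_two_sign_changes'[OF idx(2,1) _ u(1) _ T(1) that ay] ord show False by simp
    qed
    ultimately have "F b u < F a u" using u(2) by (metis linorder_less_linear)
    then show ?thesis using u(1) \<open>u < v\<close> by blast
  next
    case False
    have "F b y \<noteq> F b' y" using no_triple[OF idx(1,4,3) _ _ _ y(2)] y(2) ord by auto
    moreover have False if "F b' y < F b y"
      using no_two_sign_changes'[OF idx(3,4) _ y(1) _ T(3) that bu] False ord by simp
    ultimately have "F b y < F a y" using y(2) by (metis linorder_less_linear)
    then show ?thesis using y(1) \<open>y < v\<close> by blast
  qed
  then obtain z where z: "T < z" "z < v" "F b z < F a z" by blast
  have "F a v < F b v" using av bv v(2) by simp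
  with no_two_sign_changes'[OF idx(1,3) _ z(1,2) T(2) z(3)] ord show False by simp
qed

end

section \<open>Edge counts for ordered graphs with forbidden patterns\<close>

lemma floor_log_less_if_double_le:
  assumes "1 \<le> d" "2 * d \<le> e"
  shows "floor_log d < floor_log e"
  using floor_log_le_iff[OF assms(2)] assms(1) by simp

text \<open>Edges that at least double all shorter ones at a fixed end have distinct values of
  \<open>floor_log\<close>, so there are at most \<open>Suc (floor_log n)\<close> of them at that
  end. Lower and upper ends together account for the factor \<open>2 * n\<close>.\<close>

lemma card_le_double_log:
  fixes E :: "(nat \<times> nat) set"
  assumes edge: "\<And>a b. (a, b) \<in> E \<Longrightarrow> a < b \<and> b < n"
    and pattern: "\<And>a a' b b'. a' < a \<Longrightarrow> a < b \<Longrightarrow> b < b' \<Longrightarrow>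
      (a', b) \<in> E \<Longrightarrow> (a', b') \<in> E \<Longrightarrow> (a, b') \<in> E \<Longrightarrow> False"
  shows "card E \<le> 2 * n * Suc (floor_log n)"
proof -
  \<comment> \<open>\<open>R\<close> gathers the edges with the doubling property at the lower end,
    \<open>C\<close> those with it at the upper end.\<close>
  define R where "R = {(a, b) \<in> E. \<forall>b'<b. (a, b') \<in> E \<longrightarrow> 2 * (b' - a) \<le> b - a}"
  define C where "C = {(a, b) \<in> E. \<forall>a'>a. (a', b) \<in> E \<longrightarrow> 2 * (b - a') \<le> b - a}"
  let ?K = "{..<n} \<times> {..<Suc (floor_log n)}"
  have log: "floor_log (b - a) < Suc (floor_log n)" if "(a, b) \<in> E" for a b
    unfolding less_Suc_eq_le by (rule floor_log_le_iff) (use edge[OF that] diff_le_self[of b a] in linarith)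
  have "inj_on (\<lambda>(a, b). (a, floor_log (b - a))) R"
  proof -
    have False if "(a, b) \<in> R" "(a, b') \<in> R" "b < b'" "floor_log (b - a) = floor_log (b' - a)" for a b b'
    proof -
      have "1 \<le> b - a" "2 * (b - a) \<le> b' - a" using edge[of a b] that unfolding R_def by auto
      from floor_log_less_if_double_le[OF this] that(4) show False by simp
    qed
    then show ?thesis by (auto simp: inj_on_def) (metis linorder_neqE_nat)
  qed
  then have "card R \<le> card ?K"
    by (rule card_inj_on_le) (use edge log in \<open>force simp: R_def\<close>)+
  moreover have "inj_on (\<lambda>(a, b). (b, floor_log (b - a))) C"
  proof -
    have False if "(a, b) \<in> C" "(a', b) \<in> C" "a < a'" "floor_log (b - a) = floor_log (b - a')" for a a' b
    proof -
      have "1 \<le> b - a'" "2 * (b - a') \<le> b - a" using edge[of a' b] that unfolding C_def by auto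
      from floor_log_less_if_double_le[OF this] that(4) show False by simp
    qed
    then show ?thesis by (auto simp: inj_on_def) (metis linorder_neqE_nat)
  qed
  then have "card C \<le> card ?K"
    by (rule card_inj_on_le) (use edge log in \<open>force simp: C_def\<close>)+
  moreover have "E \<subseteq> R \<union> C"
  proof (clarify, rule ccontr)
    fix a b assume ab: "(a, b) \<in> E" "(a, b) \<notin> C" "(a, b) \<notin> R"
    then obtain a' b' where *: "a < a'" "(a', b) \<in> E" "b - a < 2 * (b - a')"
      "b' < b" "(a, b') \<in> E" "b - a < 2 * (b' - a)"
      unfolding R_def C_def by (auto simp: not_le)
    \<comment> \<open>Both competing edges cover more than half of the stretch from \<open>a\<close>
      to \<open>b\<close>, so they overlap and \<open>a' < b'\<close>. The three edges then form the
      forbidden pattern.\<close>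
    have "a < b'" "a' < b" using edge * by blast+
    with * have "a' < b'" by arith
    with pattern[of a a' b' b] * ab(1) show False by blast
  qed
  then have "card E \<le> card (R \<union> C)"
  proof (rule card_mono [rotated])
    have "E \<subseteq> {..<n} \<times> {..<n}" using edge by fastforce
    then have "finite E" by (rule finite_subset) simp
    then show "finite (R \<union> C)" unfolding R_def C_def by (auto intro: finite_subset[of _ E])
  qed
  ultimately show ?thesis using card_Un_le[of R C] by simp
qed

lemma max_tangencies_at_most_le:
  "max_tangencies at_most_one_common_family n \<le> 2 * n * Suc (floor_log n)"
  unfolding max_tangencies_def
proof (subst Max_le_iff[OF finite_tangency_counts tangency_counts_nonempty(1)], intro ballI)
  fix m assume "m \<in> tangency_counts at_most_one_common_family n"
  then obtain S where S: "m = card (tangent_pairs S)" "finite S" "card S = n" "at_most_one_common_family S"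
    unfolding tangency_counts_def by blast
  obtain F T T' where sys: "sorted_curve_system n F T" and SF: "S = (\<lambda>i. plane_graph (F i)) ` {..<n}"
    using sorted_curve_system_exists[OF S(2-4)] .
  interpret sorted_curve_system n F T by fact
  have "card (touch_pairs n F) \<le> 2 * n * Suc (floor_log n)"
    by (rule card_le_double_log) (use touch_point no_crossed_touchings in blast)+
  then show "m \<le> 2 * n * Suc (floor_log n)"
    using card_tangent_pairs unfolding S(1) SF curves_def by simp
qed

text \<open>The edges are charged injectively to the numbers from 1 to \<open>n - 1\<close>. By
  \<open>no_chain\<close> no number is charged both as a lower and as an upper end, and the first
  edge at an upper end is unique. Two edges charged to the same lower end would create the forbidden
  pattern.\<close>

lemma card_le_if_forest_like:
  fixes E :: "(nat \<times> nat) set"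
  assumes edge: "\<And>a b. (a, b) \<in> E \<Longrightarrow> a < b \<and> b < n"
    and no_chain: "\<And>a b c. (a, b) \<in> E \<Longrightarrow> (b, c) \<notin> E"
    and pattern: "\<And>a a' b b'. a' < a \<Longrightarrow> b < b' \<Longrightarrow> a < b \<Longrightarrow>
      (a', b) \<in> E \<Longrightarrow> (a', b') \<in> E \<Longrightarrow> (a, b') \<in> E \<Longrightarrow> False"
    and interval: "\<And>a a' a'' b b'. (a', b) \<in> E \<Longrightarrow> (a, b) \<in> E \<Longrightarrow> (a'', b') \<in> E \<Longrightarrow> (a, b') \<in> E \<Longrightarrow>
      a' < a'' \<Longrightarrow> a'' < a \<Longrightarrow> (a'', b) \<in> E"
  shows "card E \<le> n - 1"
proof -
  \<comment> \<open>An edge is charged to its lower end, except the first one at each upper end. The value 0 is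
    never taken.\<close>
  define h where "h = (\<lambda>(a, b). if \<exists>a'<a. (a', b) \<in> E then a else b)"
  have same_lower: False
    if e: "(a, b) \<in> E" "(a, b') \<in> E" "(a', b) \<in> E" "(a'', b') \<in> E" and "a' < a" "a'' < a" "b < b'"
    for a a' a'' b b'
  proof -
    have "a < b" using edge e(1) by blast
    \<comment> \<open>By \<open>interval\<close>, the larger of \<open>a'\<close> and
      \<open>a''\<close> is adjacent to both \<open>b\<close> and \<open>b'\<close>; it becomes the
      vertex \<open>c\<close> of the pattern.\<close>
    have "(a'', b) \<in> E" if "a' < a''" by (rule interval[of a' b a a'' b']) fact+
    moreover have "(a', b') \<in> E" if "a'' < a'" by (rule interval[of a'' b' a a' b]) fact+
    ultimately have "(a', b') \<in> E \<or> (a'', b) \<in> E" using e by (metis linorder_neqE_nat)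
    then obtain c where "c < a" "(c, b) \<in> E" "(c, b') \<in> E"
      using e \<open>a' < a\<close> \<open>a'' < a\<close> by metis
    then show False using pattern[of c a b b'] e \<open>b < b'\<close> \<open>a < b\<close> by blast
  qed
  have "inj_on h E"
  proof (rule inj_onI)
    fix e e' assume e: "e \<in> E" "e' \<in> E" "h e = h e'"
    obtain a b c d where eq: "e = (a, b)" "e' = (c, d)" by fastforce
    consider "\<exists>a'<a. (a', b) \<in> E" "\<exists>a'<c. (a', d) \<in> E" | "\<not> (\<exists>a'<a. (a', b) \<in> E)" "\<not> (\<exists>a'<c. (a', d) \<in> E)"
      | "h e = a" "h e' = d" | "h e = b" "h e' = c"
      by (cases "\<exists>a'<a. (a', b) \<in> E"; cases "\<exists>a'<c. (a', d) \<in> E") (simp_all add: h_def eq)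
    then show "e = e'"
    proof cases
      case 1
      then have "a = c" using e(3) unfolding h_def eq by simp
      then show ?thesis
        using 1 e(1,2) same_lower[of a b d] same_lower[of a d b] unfolding eq
        by (metis linorder_neqE_nat)
    next
      case 2
      then have "b = d" using e(3) unfolding h_def eq prod.case by (simp only: if_False)
      then show ?thesis using 2 e(1,2) unfolding eq by (metis linorder_neqE_nat)
    next
      case 3 then show ?thesis using e no_chain unfolding eq by metis
    next
      case 4 then show ?thesis using e no_chain unfolding eq by metis
    qed
  qed
  moreover have "h ` E \<subseteq> {1..<n}"
  proof (clarify)
    fix a b assume "(a, b) \<in> E"
    from edge[OF this] show "h (a, b) \<in> {1..<n}" unfolding h_def by auto
  qed
  ultimately show ?thesis using card_inj_on_le[of h E "{1..<n}"] by simp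
qed

text \<open>If every pair meets exactly once, a pair touches precisely when its order at
  \<open>T\<close> persists at \<open>T'\<close>. The touching graph is thus determined by two
  linear orders, and the conditions of the forest bound can be read off from them.\<close>

lemma max_tangencies_exactly_le:
  "max_tangencies exactly_one_common_family n \<le> n - 1"
  unfolding max_tangencies_def
proof (subst Max_le_iff[OF finite_tangency_counts tangency_counts_nonempty(2)], intro ballI)
  fix m assume "m \<in> tangency_counts exactly_one_common_family n"
  then obtain S where S: "m = card (tangent_pairs S)" "finite S" "card S = n"
    and exact: "exactly_one_common_family S"
    unfolding tangency_counts_def by blast
  from exact have am: "at_most_one_common_family S"
    unfolding exactly_one_common_family_def by (rule conjunct1)
  have ex: "\<exists>p. p \<in> A \<inter> B" if "A \<in> S" "B \<in> S" "A \<noteq> B" for A B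
    using exact that unfolding exactly_one_common_family_def by (metis ex1_implies_ex)
  obtain F T T' where sys: "sorted_curve_system n F T" and SF: "S = (\<lambda>i. plane_graph (F i)) ` {..<n}"
    and T': "\<And>i j x. i < n \<Longrightarrow> j < n \<Longrightarrow> i \<noteq> j \<Longrightarrow> F i x = F j x \<Longrightarrow> x < T'"
    by (rule sorted_curve_system_exists[OF S(2,3) am]) blast
  interpret sorted_curve_system n F T by fact
  have meet: "\<exists>x. F i x = F j x" if ij: "i < n" "j < n" "i \<noteq> j" for i j
  proof -
    have "plane_graph (F i) \<noteq> plane_graph (F j)"
      using inj_on_eq_iff[OF inj_plane_graph, of i j] ij by simp
    then obtain p where "p \<in> plane_graph (F i) \<inter> plane_graph (F j)"
      using ex[of "plane_graph (F i)" "plane_graph (F j)"] ij(1,2) unfolding SF by blast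
    then show ?thesis unfolding plane_graph_Int by metis
  qed
  let ?E = "touch_pairs n F"
  have E: "(i, j) \<in> ?E \<longleftrightarrow> i < j \<and> j < n \<and> F i T' < F j T'" for i j
  proof
    assume "(i, j) \<in> ?E"
    then show "i < j \<and> j < n \<and> F i T' < F j T'"
      using T'[of i j] by (metis touch_point less_irrefl less_trans)
  next
    assume ij: "i < j \<and> j < n \<and> F i T' < F j T'"
    then have ij': "i < n" "j < n" "i \<noteq> j" by auto
    obtain x where x: "F i x = F j x" using meet[OF ij'] by blast
    have "touches (F i) (F j)"
    proof (rule touches_if_same_sign[OF cont[OF ij'(1)] cont[OF ij'(2)] x])
      show "y = x" if "F i y = F j y" for y using once[OF ij' that x] .
      show "T < x" "x < T'" using before_meets[OF ij' x] T'[OF ij' x] .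
      show "F i T < F j T" "F i T' < F j T'" using sorted ij by auto
    qed
    then show "(i, j) \<in> ?E" using ij' unfolding touch_pairs_def by simp
  qed
  have "F i T' \<noteq> F j T'" if "i < n" "j < n" "i \<noteq> j" for i j using T'[OF that, of T'] by blast
  then have swapped: "F j T' < F i T'" if "i < j" "j < n" "(i, j) \<notin> ?E" for i j
    using that unfolding E by (metis less_trans linorder_less_linear less_irrefl)
  have no_chain: "(b, c) \<notin> ?E" if "(a, b) \<in> ?E" for a b c
  proof
    assume bc: "(b, c) \<in> ?E"
    \<comment> \<open>Persistence of order is transitive, so \<open>a\<close> touches
      \<open>c\<close> as well. At their contact \<open>b\<close> is squeezed between them, which
      makes a triple point.\<close>
    with that have "(a, c) \<in> ?E" unfolding E by auto
    then obtain p where p: "F a p = F c p" using touch_point by metis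
    have "F a p \<le> F b p" "F b p \<le> F c p"
      using that bc touches_le unfolding touch_pairs_def by auto
    then show False using no_triple[of a b c p] p that bc unfolding E by auto
  qed
  have "card ?E \<le> n - 1"
  proof (rule card_le_if_forest_like[where n = n])
    show "(a'', b) \<in> ?E" if "(a', b) \<in> ?E" "(a, b) \<in> ?E" "(a'', b') \<in> ?E" "(a, b') \<in> ?E" "a' < a''" "a'' < a"
      for a a' a'' b b'
    proof -
      \<comment> \<open>\<open>a''\<close> is already a lower end, so it cannot be the upper end of
        an edge from \<open>a'\<close>. Hence the two are exchanged at \<open>T'\<close>, where
        \<open>a''\<close> lies below \<open>a'\<close> and therefore below
        \<open>b\<close>.\<close>
      have "(a', a'') \<notin> ?E" using no_chain that(3) by blast
      then have "F a'' T' < F a' T'" using swapped that unfolding E by auto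
      then show ?thesis using that unfolding E by auto
    qed
    show False if "a' < a" "b < b'" "a < b" "(a', b) \<in> ?E" "(a', b') \<in> ?E" "(a, b') \<in> ?E" for a a' b b'
      using no_crossed_touchings that by metis
  qed (use E no_chain in auto)
  then show "m \<le> n - 1"
    using card_tangent_pairs unfolding S(1) SF curves_def by simp
qed

section \<open>Lower bounds\<close>

text \<open>Curve 0 is the parabola and curve \<open>i\<close> its tangent line at abscissa
  \<open>i\<close>. Two of the lines meet midway between their contacts, so the meeting abscissas of
  three curves never all agree. Each line gives one edge, with the parabola as upper curve.\<close>

lemma parabola_tangents_system:
  fixes n :: nat
  defines "F \<equiv> \<lambda>i x. if i = 0 then x\<^sup>2 else 2 * real i * x - (real i)\<^sup>2"
  shows "curve_system n F" "i \<noteq> j \<Longrightarrow> \<exists>x. F i x = F j x" "n - 1 \<le> card (touch_pairs n F)"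
proof -
  \<comment> \<open>The vertical gap is a perfect square, which yields both the contact and the side
    on which the line lies.\<close>
  have tangent_line: "F 0 x - F i x = (x - real i)\<^sup>2" if "i \<noteq> 0" for i x
    using that by (simp add: F_def power2_diff)
  have F0: "F i x = F 0 x \<longleftrightarrow> x = real i" if "i \<noteq> 0" for i x
    using tangent_line[OF that, of x] by auto
  have lines: "F i x = F j x \<longleftrightarrow> 2 * x = real i + real j" if "i \<noteq> j" "i \<noteq> 0" "j \<noteq> 0" for i j x
  proof -
    have "F i x - F j x = (real i - real j) * (2 * x - (real i + real j))"
      using that by (simp add: F_def algebra_simps power2_eq_square)
    then show ?thesis using that(1) by auto
  qed
  have meet: "F i x = F j x \<longleftrightarrow> x = (if i = 0 \<or> j = 0 then real (i + j) else (real i + real j) / 2)"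
    if "i \<noteq> j" for i j x
  proof -
    consider "i = 0" "j \<noteq> 0" | "j = 0" "i \<noteq> 0" | "i \<noteq> 0" "j \<noteq> 0" using \<open>i \<noteq> j\<close> by linarith
    then show ?thesis
    proof cases
      case 1
      have "F i x = F j x \<longleftrightarrow> F j x = F 0 x" unfolding 1(1) by (rule eq_commute)
      then show ?thesis unfolding F0[OF 1(2)] using 1 by simp
    next
      case 2
      then show ?thesis unfolding 2(1) F0[OF 2(2)] by simp
    next
      case 3
      then show ?thesis unfolding lines[OF \<open>i \<noteq> j\<close> 3] by auto
    qed
  qed
  show "\<exists>x. F i x = F j x" if "i \<noteq> j"
    unfolding meet[OF that] by simp
  show "curve_system n F"
  proof
    show "continuous_on UNIV (F i)" for i
      unfolding F_def by (cases "i = 0") (auto intro!: continuous_intros)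
    show "x = y" if "i \<noteq> j" "F i x = F j x" "F i y = F j y" for i j x y
      using that(2,3) unfolding meet[OF that(1)] by simp
    show "F i x \<noteq> F k x" if "i \<noteq> j" "i \<noteq> k" "j \<noteq> k" "F i x = F j x" for i j k x
    proof
      assume *: "F i x = F k x"
      then have **: "F j x = F k x" using that(4) by simp
      show False
        using that(1-3) that(4)[unfolded meet[OF that(1)]] *[unfolded meet[OF that(2)]]
          **[unfolded meet[OF that(3)]]
        by (auto split: if_splits)
    qed
  qed
  have "(\<lambda>i. (Suc i, 0)) ` {..<n - 1} \<subseteq> touch_pairs n F"
  proof (clarify)
    fix i assume "i < n - 1"
    moreover have "touches (F (Suc i)) (F 0)"
      unfolding touches_def
    proof (intro exI conjI allI impI)
      show "F (Suc i) (real (Suc i)) = F 0 (real (Suc i))" using F0[of "Suc i"] by simp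
      show "F (Suc i) x < F 0 x" if "x \<noteq> real (Suc i)" for x
      proof -
        have "0 < (x - real (Suc i))\<^sup>2" using that by simp
        then show ?thesis using tangent_line[of "Suc i" x] by linarith
      qed
    qed
    ultimately show "(Suc i, 0) \<in> touch_pairs n F" unfolding touch_pairs_def by auto
  qed
  then have "card ((\<lambda>i. (Suc i, 0::nat)) ` {..<n - 1}) \<le> card (touch_pairs n F)"
    by (rule card_mono[rotated]) simp
  then show "n - 1 \<le> card (touch_pairs n F)" by (simp add: card_image inj_on_def)
qed

lemma max_tangencies_exactly_ge:
  "n - 1 \<le> max_tangencies exactly_one_common_family n"
proof -
  obtain F where sys: "curve_system n F" and meet: "\<And>i j. i \<noteq> j \<Longrightarrow> \<exists>x. F i x = F j x"
    and le: "n - 1 \<le> card (touch_pairs n F)"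
    by (rule that[OF parabola_tangents_system])
  interpret curve_system n F by (fact sys)
  have "exactly_one_common_family curves"
    unfolding exactly_one_common_family_def
  proof (intro conjI ballI impI at_most_one_common_family_curves)
    fix A B assume AB: "A \<in> curves" "B \<in> curves" "A \<noteq> B"
    then obtain i j where ij: "A = plane_graph (F i)" "B = plane_graph (F j)" "i \<noteq> j"
      unfolding curves_def by auto
    obtain x where "F i x = F j x" using meet[OF ij(3)] by blast
    then have "(x, F i x) \<in> A \<inter> B" unfolding ij plane_graph_Int by simp
    moreover have "p = q" if "p \<in> A \<inter> B" "q \<in> A \<inter> B" for p q
      using at_most_one_common_family_curves[unfolded at_most_one_common_family_def, THEN conjunct2,
        THEN conjunct1, rule_format, OF AB that] .
    ultimately show "\<exists>!p. p \<in> A \<inter> B" by blast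
  qed
  then have "card (touch_pairs n F) \<in> tangency_counts exactly_one_common_family n"
    unfolding tangency_counts_def mem_Collect_eq
    by (intro exI[of _ curves]) (simp add: card_tangent_pairs finite_curves card_curves)
  then have "card (touch_pairs n F) \<le> max_tangencies exactly_one_common_family n"
    unfolding max_tangencies_def by (rule Max_ge[OF finite_tangency_counts])
  with le show ?thesis by simp
qed

text \<open>The odd copy is lifted by \<open>h\<close>: it comes down to touch the even copy at time 1 and is
  above all of it from time 2 on, when the two copies of \<open>F\<close> start to run.\<close>

lemma double_system:
  fixes F :: "nat \<Rightarrow> real \<Rightarrow> real" and K :: real
  assumes sys: "curve_system N F"
    and start: "\<And>i x. i < N \<Longrightarrow> x \<le> 0 \<Longrightarrow> F i x = real i"
    and K: "0 \<le> K" "\<And>i x. i < N \<Longrightarrow> \<bar>F i x\<bar> \<le> K * (1 + \<bar>x\<bar>)"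
  defines "h \<equiv> \<lambda>x. max (min 1 (1 - x)) ((4 * K + 1) * (x - 1))"
  defines "G \<equiv> \<lambda>i x. 2 * F (i div 2) (x - 2) + (if odd i then h x else 0)"
  shows "curve_system (2 * N) G"
    and "i < 2 * N \<Longrightarrow> x \<le> 0 \<Longrightarrow> G i x = real i"
    and "i < 2 * N \<Longrightarrow> \<bar>G i x\<bar> \<le> (10 * K + 2) * (1 + \<bar>x\<bar>)"
    and "2 * card (touch_pairs N F) + N \<le> card (touch_pairs (2 * N) G)"
proof -
  interpret curve_system N F by fact
  have h_left: "h x = min 1 (1 - x)" if "x \<le> 1" for x
  proof -
    have "(4 * K + 1) * (x - 1) \<le> 0" using that K(1) by (intro mult_nonneg_nonpos) auto
    then show ?thesis using that by (auto simp: h_def max_def min_def)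
  qed
  have h_right: "h x = (4 * K + 1) * (x - 1)" if "1 \<le> x" for x
  proof -
    have "0 \<le> (4 * K + 1) * (x - 1)" using that K(1) by simp
    then show ?thesis using that by (auto simp: h_def max_def min_def)
  qed
  have h_pos: "0 < h x" if "x \<noteq> 1" for x
  proof (cases "x < 1")
    case True then show ?thesis using h_left[of x] by simp
  next
    case False then show ?thesis using h_right[of x] that K(1) by (simp add: zero_less_mult_iff)
  qed
  have half: "i div 2 < N" if "i < 2 * N" for i using that by linarith
  have div2_inj: "i div 2 = j div 2 \<longleftrightarrow> i = j" if "even i = even j" for i j :: nat
    using that by presburger

  have same_F: "F (i div 2) (x - 2) = F (j div 2) (x - 2)" if "even i = even j" "G i x = G j x" for i j x
    using that unfolding G_def by (cases "even i") simp_all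
  \<comment> \<open>Up to time 2 each copy of \<open>F\<close> rests at distinct constant heights
    and the lift is common to a parity class, so curves of equal parity can meet only later.\<close>
  have same: "2 < x" if ij: "i < 2 * N" "j < 2 * N" "i \<noteq> j" "even i = even j" "G i x = G j x" for i j x
  proof (rule ccontr)
    assume "\<not> 2 < x"
    then have "real (i div 2) = real (j div 2)"
      using same_F[OF ij(4,5)] start[OF half[OF ij(1)], of "x - 2"] start[OF half[OF ij(2)], of "x - 2"]
      by simp
    with ij(3,4) div2_inj show False by simp
  qed
  \<comment> \<open>Before time 1 the lift is positive and at most 1, so it is no difference of even
    integers. From time 2 on its slope \<open>4 * K + 1\<close> outruns the differences, which are
    at most \<open>4 * (K * (x - 1))\<close>. In between it is linear, so the equation determines
    \<open>x\<close>.\<close>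
  have diff: "x < 2 \<and> 1 \<le> x \<and> (4 * K + 1) * (x - 1) = 2 * real (i div 2) - 2 * real (j div 2)"
    if ij: "i < 2 * N" "j < 2 * N" "even i" "odd j" "G i x = G j x" for i j x
  proof -
    have eq: "h x = 2 * F (i div 2) (x - 2) - 2 * F (j div 2) (x - 2)"
      using ij by (simp add: G_def)
    have "x < 2"
    proof (rule ccontr)
      assume "\<not> x < 2"
      then have "\<bar>F (i div 2) (x - 2)\<bar> \<le> K * (x - 1)" "\<bar>F (j div 2) (x - 2)\<bar> \<le> K * (x - 1)"
        using K(2)[OF half[OF ij(1)], of "x - 2"] K(2)[OF half[OF ij(2)], of "x - 2"] by (simp_all add: algebra_simps)
      with eq have "h x \<le> 4 * (K * (x - 1))" by linarith
      moreover have "h x = 4 * (K * (x - 1)) + (x - 1)" using h_right[of x] \<open>\<not> x < 2\<close> by (simp add: algebra_simps)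
      ultimately show False using \<open>\<not> x < 2\<close> by simp
    qed
    then have eq': "h x = 2 * real (i div 2) - 2 * real (j div 2)"
      using eq start[OF half[OF ij(1)], of "x - 2"] start[OF half[OF ij(2)], of "x - 2"] by simp
    have "1 \<le> x"
    proof (rule ccontr)
      assume "\<not> 1 \<le> x"
      then have "0 < h x" "h x \<le> 1" using h_left[of x] by auto
      then have "real (j div 2) < real (i div 2)" "2 * real (i div 2) \<le> 2 * real (j div 2) + 1"
        using eq' by linarith+
      then have "real (j div 2) + 1 \<le> real (i div 2)" by simp
      then show False using \<open>2 * real (i div 2) \<le> 2 * real (j div 2) + 1\<close> by linarith
    qed
    with \<open>x < 2\<close> show ?thesis using eq' h_right[of x] by simp
  qed
  have diff': "x < 2" if "i < 2 * N" "j < 2 * N" "even i \<noteq> even j" "G i x = G j x" for i j x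
    using diff[of i j x] diff[of j i x] that by (cases "even i") auto

  show "curve_system (2 * N) G"
  proof
    fix i assume "i < 2 * N"
    then have "continuous_on UNIV (\<lambda>x. F (i div 2) (x - 2))"
      by (intro continuous_on_compose2[OF cont[OF half]]) (auto intro!: continuous_intros)
    then show "continuous_on UNIV (G i)"
      unfolding G_def h_def by (cases "odd i") (auto intro!: continuous_intros)
  next
    fix i j x y assume ij: "i < 2 * N" "j < 2 * N" "i \<noteq> j" and xy: "G i x = G j x" "G i y = G j y"
    show "x = y"
    proof (cases "even i = even j")
      case True
      then have "i div 2 \<noteq> j div 2" using ij(3) div2_inj by simp
      then have "x - 2 = y - 2"
        using once[OF half[OF ij(1)] half[OF ij(2)]] same_F[OF True xy(1)] same_F[OF True xy(2)] by blast
      then show ?thesis by simp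
    next
      case False
      then have "(4 * K + 1) * (x - 1) = (4 * K + 1) * (y - 1)"
        using diff[of i j x] diff[of j i x] diff[of i j y] diff[of j i y] ij xy by (cases "even i") simp_all
      moreover have "4 * K + 1 \<noteq> 0" using K(1) by linarith
      ultimately show ?thesis by simp
    qed
  next
    fix i j k x
    assume ijk: "i < 2 * N" "j < 2 * N" "k < 2 * N" "i \<noteq> j" "i \<noteq> k" "j \<noteq> k" and eq: "G i x = G j x"
    show "G i x \<noteq> G k x"
    proof
      assume eq': "G i x = G k x"
      show False
      proof (cases "even i = even j \<and> even i = even k")
        case True
        then have "i div 2 \<noteq> j div 2" "i div 2 \<noteq> k div 2" "j div 2 \<noteq> k div 2"
          using ijk(4-6) div2_inj[of i j] div2_inj[of i k] div2_inj[of j k] by blast+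
        from no_triple[OF half[OF ijk(1)] half[OF ijk(2)] half[OF ijk(3)] this, of "x - 2"]
        show False using True same_F[OF _ eq] same_F[OF _ eq'] by blast
      next
        case False
        have eq'': "G j x = G k x" using eq eq' by simp
        \<comment> \<open>Two of three indices share a parity, which forces \<open>2 < x\<close>; if
          not all three do, some pair of different parity forces \<open>x < 2\<close>.\<close>
        have "even i = even j \<or> even i = even k \<or> even j = even k" by blast
        then have "2 < x"
          using same[OF ijk(1,2,4) _ eq] same[OF ijk(1,3,5) _ eq'] same[OF ijk(2,3,6) _ eq''] by argo
        moreover have "x < 2"
          using False diff'[OF ijk(1,2) _ eq] diff'[OF ijk(1,3) _ eq'] by argo
        ultimately show False by simp
      qed
    qed
  qed

  show "G i x = real i" if "i < 2 * N" "x \<le> 0" for i x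
  proof -
    have "2 * real (i div 2) + (if odd i then 1 else 0) = real i"
      by (auto elim!: evenE oddE)
    then show ?thesis
      using that start[OF half[OF that(1)], of "x - 2"] h_left[of x] unfolding G_def
      by (cases "even i") simp_all
  qed

  show "\<bar>G i x\<bar> \<le> (10 * K + 2) * (1 + \<bar>x\<bar>)" if "i < 2 * N" for i x
  proof -
    have "\<bar>F (i div 2) (x - 2)\<bar> \<le> K * (3 + \<bar>x\<bar>)"
      by (rule order.trans[OF K(2)[OF half[OF that]]]) (use K(1) in \<open>auto intro!: mult_left_mono\<close>)
    also have "\<dots> \<le> K * (3 * (1 + \<bar>x\<bar>))" using K(1) by (intro mult_left_mono) auto
    finally have F: "\<bar>F (i div 2) (x - 2)\<bar> \<le> 3 * (K * (1 + \<bar>x\<bar>))" by (simp only: mult.left_commute)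
    have "\<bar>h x\<bar> \<le> (4 * K + 1) * (1 + \<bar>x\<bar>)"
    proof (cases "x \<le> 1")
      case True
      then have "\<bar>h x\<bar> \<le> 1" using h_left[of x] by auto
      also have "\<dots> \<le> (4 * K + 1) * (1 + \<bar>x\<bar>)"
        using mult_mono[of 1 "4 * K + 1" 1 "1 + \<bar>x\<bar>"] K(1) by simp
      finally show ?thesis .
    next
      case False
      then have "\<bar>h x\<bar> = (4 * K + 1) * (x - 1)" using h_right[of x] K(1) by simp
      also have "\<dots> \<le> (4 * K + 1) * (1 + \<bar>x\<bar>)" using K(1) by (intro mult_left_mono) auto
      finally show ?thesis .
    qed
    then have h: "\<bar>h x\<bar> \<le> 4 * (K * (1 + \<bar>x\<bar>)) + (1 + \<bar>x\<bar>)" by (simp add: algebra_simps)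
    have "\<bar>G i x\<bar> \<le> 2 * \<bar>F (i div 2) (x - 2)\<bar> + \<bar>h x\<bar>"
      unfolding G_def by (cases "odd i") (simp_all only: if_True if_False not_False_eq_True)
    \<comment> \<open>The doubled and shifted copy contributes \<open>6 * K\<close> and the lift
      \<open>4 * K + 1\<close>, in total at most \<open>10 * K + 2\<close>.\<close>
    also have "\<dots> \<le> 2 * (3 * (K * (1 + \<bar>x\<bar>))) + (4 * (K * (1 + \<bar>x\<bar>)) + (1 + \<bar>x\<bar>))"
      by (intro add_mono mult_left_mono F h) simp
    also have "\<dots> \<le> 10 * (K * (1 + \<bar>x\<bar>)) + 2 * (1 + \<bar>x\<bar>)" by simp
    finally show ?thesis by (simp add: algebra_simps)
  qed

  \<comment> \<open>\<open>E0\<close> and \<open>E1\<close> are the edges inherited by the two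
    copies, \<open>E2\<close> the contacts of twins at time 1. The parities of the ends keep the
    three sets disjoint.\<close>
  define P where "P = touch_pairs N F"
  define E0 where "E0 = (\<lambda>(i, j). (2 * i, 2 * j)) ` P"
  define E1 where "E1 = (\<lambda>(i, j). (2 * i + 1, 2 * j + 1)) ` P"
  define E2 where "E2 = (\<lambda>i. (2 * i, 2 * i + 1)) ` {..<N}"
  have touches_copy: "touches (G (2 * i + e)) (G (2 * j + e))" if "touches (F i) (F j)" and e: "e = 0 \<or> e = 1" for i j e
  proof -
    obtain p where p: "F i p = F j p" "\<And>x. x \<noteq> p \<Longrightarrow> F i x < F j x"
      using \<open>touches (F i) (F j)\<close> unfolding touches_def by blast
    have lt: "F i (x - 2) < F j (x - 2)" if "x \<noteq> p + 2" for x using p(2)[of "x - 2"] that by simp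
    have idx: "(2 * k + e) div 2 = k" "odd (2 * k + e) \<longleftrightarrow> e = 1" for k using e by auto
    show ?thesis
      unfolding touches_def G_def idx
    proof (intro exI[of _ "p + 2"] conjI allI impI)
      show "2 * F i (p + 2 - 2) + (if e = 1 then h (p + 2) else 0) =
          2 * F j (p + 2 - 2) + (if e = 1 then h (p + 2) else 0)"
        using p(1) by simp
      show "2 * F i (x - 2) + (if e = 1 then h x else 0) < 2 * F j (x - 2) + (if e = 1 then h x else 0)"
        if "x \<noteq> p + 2" for x
        using lt[OF that] by simp
    qed
  qed
  have touches_twin: "touches (G (2 * i)) (G (2 * i + 1))" for i
    unfolding touches_def G_def using h_pos h_left[of 1] by (intro exI[of _ 1]) simp
  have "E0 \<subseteq> touch_pairs (2 * N) G"
    unfolding E0_def P_def touch_pairs_def using touches_copy[of _ _ 0] by auto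
  moreover have "E1 \<subseteq> touch_pairs (2 * N) G"
    unfolding E1_def P_def touch_pairs_def using touches_copy[of _ _ 1] by auto
  moreover have "E2 \<subseteq> touch_pairs (2 * N) G"
    unfolding E2_def touch_pairs_def using touches_twin by auto
  ultimately have "E0 \<union> E1 \<union> E2 \<subseteq> touch_pairs (2 * N) G" by blast
  then have "card (E0 \<union> E1 \<union> E2) \<le> card (touch_pairs (2 * N) G)"
    by (rule card_mono[rotated]) simp
  moreover have "card (E0 \<union> E1 \<union> E2) = card E0 + card E1 + card E2"
  proof -
    have fin: "finite E0" "finite E1" "finite E2" unfolding E0_def E1_def E2_def P_def by simp_all
    have "even (fst e) \<and> even (snd e)" if "e \<in> E0" for e using that unfolding E0_def by auto
    moreover have "odd (fst e) \<and> odd (snd e)" if "e \<in> E1" for e using that unfolding E1_def by auto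
    moreover have "even (fst e) \<and> odd (snd e)" if "e \<in> E2" for e using that unfolding E2_def by auto
    ultimately have "E0 \<inter> E1 = {}" "(E0 \<union> E1) \<inter> E2 = {}" unfolding disjoint_iff Un_iff by metis+
    with fin show ?thesis by (simp add: card_Un_disjoint)
  qed
  moreover have "card E0 = card P" "card E1 = card P"
    unfolding E0_def E1_def by (rule card_image; auto simp: inj_on_def)+
  moreover have "card E2 = N" unfolding E2_def by (simp add: card_image inj_on_def)
  ultimately show "2 * card (touch_pairs N F) + N \<le> card (touch_pairs (2 * N) G)"
    unfolding P_def by simp
qed

text \<open>Doubling turns \<open>t\<close> edges on \<open>N\<close> curves into at least
  \<open>2 * t + N\<close> on \<open>2 * N\<close> curves; iterating gives half of
  \<open>k * 2 ^ k\<close>. The resting heights and the growth constant are carried along because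
  the next doubling requires them.\<close>

lemma power_two_system:
  "\<exists>F K. curve_system (2 ^ k) F \<and> (\<forall>i<2 ^ k. \<forall>x\<le>0. F i x = real i) \<and>
     0 \<le> K \<and> (\<forall>i<2 ^ k. \<forall>x. \<bar>F i x\<bar> \<le> K * (1 + \<bar>x\<bar>)) \<and>
     k * 2 ^ k \<le> 2 * card (touch_pairs (2 ^ k) F)"
proof (induction k)
  case 0
  show ?case
    by (rule exI[of _ "\<lambda>_ _. 0"], rule exI[of _ 0]) (auto simp: curve_system_def)
next
  case (Suc k)
  then obtain F K where F: "curve_system (2 ^ k) F" "\<And>i x. i < 2 ^ k \<Longrightarrow> x \<le> 0 \<Longrightarrow> F i x = real i"
    "0 \<le> K" "\<And>i x. i < 2 ^ k \<Longrightarrow> \<bar>F i x\<bar> \<le> K * (1 + \<bar>x\<bar>)"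
    and card: "k * 2 ^ k \<le> 2 * card (touch_pairs (2 ^ k) F)"
    by blast
  define G where "G i x = 2 * F (i div 2) (x - 2) +
    (if odd i then max (min 1 (1 - x)) ((4 * K + 1) * (x - 1)) else 0)" for i x
  note D = double_system[OF F, folded G_def]
  show ?case
  proof (intro exI conjI allI impI)
    show "curve_system (2 ^ Suc k) G" using D(1) by simp
    show "Suc k * 2 ^ Suc k \<le> 2 * card (touch_pairs (2 ^ Suc k) G)"
      using card D(4) by simp
    show "0 \<le> 10 * K + 2" using F(3) by simp
    show "G i x = real i" if "i < 2 ^ Suc k" "x \<le> 0" for i x using D(2) that by simp
    show "\<bar>G i x\<bar> \<le> (10 * K + 2) * (1 + \<bar>x\<bar>)" if "i < 2 ^ Suc k" for i x using D(3) that by simp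
  qed
qed

text \<open>A curve strictly above all others meets none of them and preserves every touching. Such
  padding reaches the sizes between powers of two.\<close>

lemma curve_system_extend:
  assumes "curve_system n F"
  obtains F' where "curve_system (Suc n) F'" "touch_pairs n F \<subseteq> touch_pairs (Suc n) F'"
proof -
  interpret curve_system n F by fact
  define g where "g x = 1 + (\<Sum>i<n. \<bar>F i x\<bar>)" for x
  define F' where "F' = F(n := g)"
  have above: "F i x < g x" if "i < n" for i x
    using member_le_sum[of i "{..<n}" "\<lambda>i. \<bar>F i x\<bar>"] that by (simp add: g_def)
  have F': "F' i = F i" if "i < n" for i using that by (simp add: F'_def)
  have meet: "i < n \<and> j < n" if "i < Suc n" "j < Suc n" "i \<noteq> j" "F' i x = F' j x" for i j x
    using above[of i x] above[of j x] that by (auto simp: F'_def less_Suc_eq split: if_splits)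
  have "curve_system (Suc n) F'"
  proof
    fix i assume "i < Suc n"
    moreover have "continuous_on UNIV g"
      unfolding g_def using cont by (auto intro!: continuous_intros)
    ultimately show "continuous_on UNIV (F' i)"
      using cont[of i] by (cases "i = n") (simp_all add: F'_def)
  next
    fix i j x y assume "i < Suc n" "j < Suc n" "i \<noteq> j" "F' i x = F' j x" "F' i y = F' j y"
    then show "x = y" using meet[of i j x] F' once[of i j x y] by metis
  next
    fix i j k x assume "i < Suc n" "j < Suc n" "k < Suc n" "i \<noteq> j" "i \<noteq> k" "j \<noteq> k" "F' i x = F' j x"
    then show "F' i x \<noteq> F' k x"
      using meet[of i j x] meet[of i k x] F' no_triple[of i j k x] by metis
  qed
  moreover have "touch_pairs n F \<subseteq> touch_pairs (Suc n) F'"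
    unfolding touch_pairs_def by (auto simp: F')
  ultimately show thesis by (rule that)
qed

lemma max_tangencies_at_most_ge:
  assumes "2 ^ k \<le> n"
  shows "k * 2 ^ k \<le> 2 * max_tangencies at_most_one_common_family n"
proof -
  from assms have "\<exists>F. curve_system n F \<and> k * 2 ^ k \<le> 2 * card (touch_pairs n F)"
  proof (induction n rule: dec_induct)
    case base
    show ?case using power_two_system by blast
  next
    case (step n)
    then obtain F where F: "curve_system n F" "k * 2 ^ k \<le> 2 * card (touch_pairs n F)" by blast
    obtain F' where F': "curve_system (Suc n) F'" "touch_pairs n F \<subseteq> touch_pairs (Suc n) F'"
      using curve_system_extend[OF F(1)] .
    have "card (touch_pairs n F) \<le> card (touch_pairs (Suc n) F')"
      by (rule card_mono[OF _ F'(2)]) simp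
    with F(2) F'(1) show ?case by (intro exI[of _ F']) simp
  qed
  then obtain F where "curve_system n F" and le: "k * 2 ^ k \<le> 2 * card (touch_pairs n F)" by blast
  then interpret curve_system n F by simp
  show ?thesis using le card_touch_pairs_le_max by simp
qed

section \<open>Logarithm estimates and the asymptotic statement\<close>

lemma floor_log_bounds:
  assumes "4 \<le> n"
  shows "real (Suc (floor_log n)) \<le> 2 / ln 2 * ln (real n)" "1 / (2 * ln 2) * ln (real n) \<le> real (floor_log n)"
proof -
  have n: "2 ^ floor_log n \<le> n" "n < 2 * 2 ^ floor_log n"
    using floor_log_exp2_le[of n] floor_log_exp2_gt[of n] assms by auto
  \<comment> \<open>For \<open>n\<close> at least 4 the value of \<open>floor_log n\<close> is large
    enough for a factor 2 to absorb the \<open>Suc\<close>.\<close>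
  have "4 = (2::nat) ^ 2" by simp
  then have l2: "2 \<le> floor_log n" using floor_log_le_iff[OF assms] by (metis floor_log_power)
  have r: "2 ^ floor_log n \<le> real n" "real n \<le> 2 ^ Suc (floor_log n)"
    using of_nat_mono[OF n(1), where 'a = real] of_nat_mono[OF less_imp_le[OF n(2)], where 'a = real]
    by simp_all
  have "real (floor_log n) * ln 2 = ln (2 ^ floor_log n)" by (simp add: ln_realpow)
  also have "\<dots> \<le> ln (real n)" using r(1) assms by (subst ln_le_cancel_iff) simp_all
  finally have upper: "real (floor_log n) * ln 2 \<le> ln (real n)" .
  have "ln (real n) \<le> ln (2 ^ Suc (floor_log n))"
    using r(2) assms by (subst ln_le_cancel_iff) simp_all
  also have "\<dots> = real (Suc (floor_log n)) * ln 2" by (rule ln_realpow)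
  finally have lower: "ln (real n) \<le> real (Suc (floor_log n)) * ln 2" .
  have "real (Suc (floor_log n)) * ln 2 \<le> (2 * real (floor_log n)) * ln 2"
    using l2 by (intro mult_right_mono) auto
  with upper lower have "real (Suc (floor_log n)) * ln 2 \<le> 2 * ln (real n)"
    "ln (real n) \<le> real (floor_log n) * (2 * ln 2)"
    by linarith+
  then have "real (Suc (floor_log n)) \<le> 2 * ln (real n) / ln 2"
    "ln (real n) / (2 * ln 2) \<le> real (floor_log n)"
    by (simp_all add: pos_le_divide_eq pos_divide_le_eq del: of_nat_Suc)
  then show "real (Suc (floor_log n)) \<le> 2 / ln 2 * ln (real n)"
    "1 / (2 * ln 2) * ln (real n) \<le> real (floor_log n)"
    by simp_all
qed

theorem theorem7:
  "(\<lambda>n. real (max_tangencies at_most_one_common_family n)) \<in> \<Theta>(\<lambda>n. real n * ln (real n)) \<and>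
   (\<forall>n\<ge>1. max_tangencies exactly_one_common_family n = n - 1)"
proof (intro conjI allI impI)
  let ?M = "max_tangencies at_most_one_common_family"
  show "(\<lambda>n. real (?M n)) \<in> \<Theta>(\<lambda>n. real n * ln (real n))"
  proof (rule bigthetaI)
    show "(\<lambda>n. real (?M n)) \<in> O(\<lambda>n. real n * ln (real n))"
    \<comment> \<open>The constant is the 2 of the edge count times \<open>2 / ln 2\<close> from
      \<open>floor_log_bounds\<close>.\<close>
    proof (rule landau_o.bigI[of "4 / ln 2"])
      show "\<forall>\<^sub>F n in at_top. norm (real (?M n)) \<le> 4 / ln 2 * norm (real n * ln (real n))"
        using eventually_ge_at_top[of 4]
      proof eventually_elim
        case (elim n)
        have "real (?M n) \<le> 2 * real n * real (Suc (floor_log n))"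
          using of_nat_mono[OF max_tangencies_at_most_le[of n], where 'a = real]
          by (simp only: of_nat_mult of_nat_numeral)
        also have "\<dots> \<le> 2 * real n * (2 / ln 2 * ln (real n))"
          using floor_log_bounds(1)[OF elim] by (intro mult_left_mono) auto
        finally show ?case using elim by (simp add: abs_mult)
      qed
    qed simp
    show "(\<lambda>n. real (?M n)) \<in> \<Omega>(\<lambda>n. real n * ln (real n))"
    \<comment> \<open>The logarithm estimate gives \<open>1 / (2 * ln 2)\<close>; one half comes
      from the edge count and another from rounding \<open>n\<close> down to a power of two.\<close>
    proof (rule landau_omega.bigI[of "1 / (8 * ln 2)"])
      show "\<forall>\<^sub>F n in at_top. norm (real (?M n)) \<ge> 1 / (8 * ln 2) * norm (real n * ln (real n))"
        using eventually_ge_at_top[of 4]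
      proof eventually_elim
        case (elim n)
        let ?k = "floor_log n"
        have "2 ^ ?k \<le> n" using floor_log_exp2_le[of n] elim by simp
        then have "?k * 2 ^ ?k \<le> 2 * ?M n" by (rule max_tangencies_at_most_ge)
        moreover have "?k * n \<le> ?k * (2 * 2 ^ ?k)"
          using floor_log_exp2_ge[of n] by (rule mult_le_mono2)
        ultimately have "?k * n \<le> 4 * ?M n" by linarith
        from of_nat_mono[OF this, where 'a = real] have le: "real ?k * real n \<le> 4 * real (?M n)"
          by (simp only: of_nat_mult of_nat_numeral)
        have "1 / (8 * ln 2) * (real n * ln (real n)) = 1 / (2 * ln 2) * ln (real n) * real n / 4"
          by simp
        also have "\<dots> \<le> real ?k * real n / 4"
          using floor_log_bounds(2)[OF elim] by (intro divide_right_mono mult_right_mono) auto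
        also have "\<dots> \<le> real (?M n)" using le by simp
        finally show ?case using elim by (simp add: abs_mult)
      qed
    qed simp
  qed
  fix n :: nat
  show "max_tangencies exactly_one_common_family n = n - 1"
    using max_tangencies_exactly_le max_tangencies_exactly_ge by (rule antisym)
qed

end
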